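(* Let $F$ and $G$ be distributions on $\mathbb{R}$ such that $F$ is subexponential, the measure $F+G$ is long-tailed, and $\overline{G}(x)=O(\overline{F}(x))$ as $x\to\infty$. Then $F*G$ is subexponential and $$\overline{F*G}(x)=\overline{F}(x)+\overline{G}(x)+o(\overline{F}(x))\quad\text{as }x\to\infty.$$
   Context: A distribution is a (Borel) probability measure on $\mathbb{R}$. For a finite Borel measure $F$ on $\mathbb{R}$ the tail function is $\overline{F}(x)=F((x,\infty))$; $F*G$ denotes convolution. A finite measure $F$ on $\mathbb{R}$ is long-tailed if $\overline{F}(x)>0$ for all $x$ and, for every constant $a\in\mathbb{R}$, $\overline{F}(x+a)/\overline{F}(x)\to 1$ as $x\to\infty$. A distribution $F$ on $\mathbb{R}$ is subexponential if it is long-tailed and $\overline{F*F}(x)=2\overline{F}(x)+o(\overline{F}(x))$ as $x\to\infty$. *)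

theory Defs
  imports "HOL-Probability.Probability" "HOL-Library.Landau_Symbols"
begin

definition tail_fn :: "real measure \<Rightarrow> real \<Rightarrow> real" where
  "tail_fn F x = measure F {x<..}"

definition long_tailed :: "real measure \<Rightarrow> bool" where
  "long_tailed F \<longleftrightarrow>
     finite_borel_measure F \<and>
     (\<forall>x. tail_fn F x > 0) \<and>
     (\<forall>a. ((\<lambda>x. tail_fn F (x + a) / tail_fn F x) \<longlongrightarrow> 1) at_top)"

definition subexponential :: "real measure \<Rightarrow> bool" where
  "subexponential F \<longleftrightarrow>
     real_distribution F \<and>
     long_tailed F \<and>
     (\<lambda>x. tail_fn (convolution F F) x - 2 * tail_fn F x) \<in> o[at_top](tail_fn F)"

(* The pointwise sum of two measures on the same sigma-algebra; the order-theoretic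
   sup on type measure is the lattice join of measures, not their sum. *)
definition measure_sum :: "'a measure \<Rightarrow> 'a measure \<Rightarrow> 'a measure" where
  "measure_sum F G = measure_of (space F) (sets F) (\<lambda>A. emeasure F A + emeasure G A)"

lemma space_measure_sum [simp]: "space (measure_sum F G) = space F"
  and sets_measure_sum [simp, measurable_cong]: "sets (measure_sum F G) = sets F"
  by (simp_all add: measure_sum_def)

lemma emeasure_measure_sum:
  assumes "sets G = sets F" "A \<in> sets F"
  shows "emeasure (measure_sum F G) A = emeasure F A + emeasure G A"
proof (rule emeasure_measure_of[OF measure_sum_def])
  show "sets F \<subseteq> Pow (space F)"
    by (rule sets.space_closed)
  show "A \<in> sets (measure_sum F G)"
    using assms by simp
  show "positive (sets (measure_sum F G)) (\<lambda>A. emeasure F A + emeasure G A)"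
    by (simp add: positive_def)
  show "countably_additive (sets (measure_sum F G)) (\<lambda>A. emeasure F A + emeasure G A)"
  proof (rule countably_additiveI)
    fix B :: "nat \<Rightarrow> 'a set"
    assume B: "range B \<subseteq> sets (measure_sum F G)" "disjoint_family B"
    have "range B \<subseteq> sets F" "range B \<subseteq> sets G"
      using B(1) assms(1) by simp_all
    with B(2) show "(\<Sum>i. emeasure F (B i) + emeasure G (B i)) =
        emeasure F (\<Union>i. B i) + emeasure G (\<Union>i. B i)"
      by (simp add: suminf_add[symmetric] suminf_emeasure)
  qed
qed

lemma finite_borel_measure_measure_sum:
  assumes "finite_borel_measure F" "finite_borel_measure G"
  shows "finite_borel_measure (measure_sum F G)"
proof -
  interpret F: finite_borel_measure F by fact
  interpret G: finite_borel_measure G by fact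
  have s: "sets G = sets F"
    by (simp add: F.M_is_borel G.M_is_borel)
  have "finite_measure (measure_sum F G)"
    by (rule finite_measureI) (simp add: emeasure_measure_sum[OF s] F.emeasure_eq_measure G.emeasure_eq_measure)
  then show ?thesis
    by (simp add: finite_borel_measure_def finite_borel_measure_axioms_def F.M_is_borel)
qed

lemma tail_fn_measure_sum:
  assumes "finite_borel_measure F" "finite_borel_measure G"
  shows "tail_fn (measure_sum F G) x = tail_fn F x + tail_fn G x"
proof -
  interpret F: finite_borel_measure F by fact
  interpret G: finite_borel_measure G by fact
  have "emeasure (measure_sum F G) {x<..} = emeasure F {x<..} + emeasure G {x<..}"
    by (rule emeasure_measure_sum) (simp_all add: F.M_is_borel G.M_is_borel)
  then show ?thesis
    unfolding tail_fn_def
    by (simp add: measure_def enn2real_plus F.emeasure_finite G.emeasure_finite less_top[symmetric] del: F.emeasure_eq_measure G.emeasure_eq_measure)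
qed

end

theory Submission
  imports Defs
begin

text \<open>
  The proof is the principle of one big jump. If \<open>U\<close>, \<open>V\<close> are independent, then apart from the
  event that both exceed a level \<open>a\<close>, the sum \<open>U + V\<close> can exceed \<open>x\<close> only if one of the two
  exceeds \<open>x - a\<close>. So the tail of a convolution is, up to shifts by \<open>a\<close> and mass outside
  \<open>{-a<..a}\<close>, the sum of the two tails plus the probability that both jumps exceed \<open>a\<close>
  (lemmas \<open>tail_fn_convolution_le\<close> and \<open>tail_fn_convolution_ge\<close>).

  For \<open>F * F\<close>, subexponentiality says precisely that this last probability is negligible relative
  to the tail of \<open>F\<close> when first \<open>x\<close> and then \<open>a\<close> become large. It is an integral of a tail in either
  of its two measures, hence monotone in the tails of both, so it stays negligible when each copy
  of \<open>F\<close> is replaced by a measure whose tail is \<open>O\<close> of that of \<open>F\<close>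
  (lemma \<open>two_big_jumps_le_of_tail_le\<close>). If moreover the tails of these measures have
  increments negligible against the tail of \<open>F\<close>, then the shifts by \<open>a\<close> do not matter either, and the
  tail of the convolution is the sum of the tails (lemma \<open>tail_fn_convolution_asymp\<close>).

  The theorem follows by using this lemma twice, always with \<open>F\<close> as reference. For the pair
  \<open>F\<close>, \<open>G\<close> it gives the tail of \<open>F * G\<close>, which is therefore \<open>O\<close> of the tail of \<open>F\<close> and inherits
  small increments from \<open>F + G\<close>. So the lemma applies to \<open>F * G\<close> convolved with itself.
\<close>

section \<open>One big jump or two\<close>

definition two_big_jumps :: "real measure \<Rightarrow> real measure \<Rightarrow> real \<Rightarrow> real \<Rightarrow> real" where
  "two_big_jumps M N a x = measure (M \<Otimes>\<^sub>M N) {(u, v). a < u \<and> a < v \<and> x < u + v}"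

lemma pair_prob_space_real_distributions:
  assumes "real_distribution M" "real_distribution N"
  shows "pair_prob_space M N"
proof -
  interpret M: real_distribution M by fact
  interpret N: real_distribution N by fact
  show ?thesis ..
qed

lemma sets_pair_real_distributions:
  assumes "real_distribution M" "real_distribution N"
  shows "sets (M \<Otimes>\<^sub>M N) = sets (borel \<Otimes>\<^sub>M borel)"
  using assms by (intro sets_pair_measure_cong real_distribution.events_eq_borel)

lemma sets_two_big_jumps:
  "{(u, v). a < u \<and> a < v \<and> x < u + v} \<in> sets (borel \<Otimes>\<^sub>M borel :: (real \<times> real) measure)"
proof -
  have "{p \<in> space (borel \<Otimes>\<^sub>M borel). a < fst p \<and> a < snd p \<and> x < fst p + snd p}
      \<in> sets (borel \<Otimes>\<^sub>M borel :: (real \<times> real) measure)"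
    by measurable
  then show ?thesis by (simp add: case_prod_beta' space_pair_measure)
qed

lemma measure_pair_Times:
  assumes "real_distribution M" "real_distribution N" "A \<in> sets borel" "B \<in> sets borel"
  shows "measure (M \<Otimes>\<^sub>M N) (A \<times> B) = measure M A * measure N B"
proof -
  interpret M: real_distribution M by fact
  interpret N: real_distribution N by fact
  show ?thesis
    using assms(3,4) by (simp add: measure_def N.emeasure_pair_measure_Times enn2real_mult)
qed

lemma real_distribution_convolution:
  assumes "real_distribution M" "real_distribution N"
  shows "real_distribution (convolution M N)"
proof -
  interpret pair_prob_space M N by (rule pair_prob_space_real_distributions) fact+
  have "(\<lambda>(u, v). u + v :: real) \<in> measurable (M \<Otimes>\<^sub>M N) borel"
    by (subst measurable_cong_sets[OF sets_pair_real_distributions[OF assms] refl]) measurable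
  then have "prob_space (convolution M N)"
    unfolding convolution_def by (rule prob_space_distr)
  then show ?thesis
    by (simp add: real_distribution_def real_distribution_axioms_def)
qed

lemma tail_fn_convolution:
  assumes "real_distribution M" "real_distribution N"
  shows "tail_fn (convolution M N) x = measure (M \<Otimes>\<^sub>M N) {(u, v). x < u + v}"
proof -
  interpret M: real_distribution M by fact
  interpret N: real_distribution N by fact
  interpret pair_prob_space M N by (rule pair_prob_space_real_distributions) fact+
  have "(\<lambda>(u, v). u + v :: real) \<in> measurable (M \<Otimes>\<^sub>M N) borel"
    by (subst measurable_cong_sets[OF sets_pair_real_distributions[OF assms] refl]) measurable
  moreover have "(\<lambda>(u, v). u + v) -` {x<..} \<inter> space (M \<Otimes>\<^sub>M N) = {(u, v). x < u + v}"
    by (auto simp: space_pair_measure)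
  ultimately show ?thesis
    unfolding tail_fn_def convolution_def by (simp add: measure_distr)
qed

text \<open>
  If \<open>u + v > x\<close> and one of the two jumps is at most \<open>a\<close>, then the other exceeds \<open>x - a\<close>.
\<close>

lemma tail_fn_convolution_le:
  assumes MN: "real_distribution M" "real_distribution N"
  shows "tail_fn (convolution M N) x
    \<le> tail_fn M (x - a) + tail_fn N (x - a) + two_big_jumps M N a x"
proof -
  interpret M: real_distribution M by fact
  interpret N: real_distribution N by fact
  interpret pair_prob_space M N by (rule pair_prob_space_real_distributions) fact+
  note sets = sets_pair_real_distributions[OF MN]
  let ?A = "{x - a<..} \<times> (UNIV :: real set)" and ?B = "(UNIV :: real set) \<times> {x - a<..}"
    and ?J = "{(u, v). a < u \<and> a < v \<and> x < u + v}"
  have s: "?A \<in> sets (M \<Otimes>\<^sub>M N)" "?B \<in> sets (M \<Otimes>\<^sub>M N)" "?J \<in> sets (M \<Otimes>\<^sub>M N)"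
    using sets_two_big_jumps[of a x] by (auto simp: sets)
  have "{(u, v). x < u + v} \<subseteq> ?A \<union> ?B \<union> ?J"
    by auto
  then have "prob {(u, v). x < u + v} \<le> prob (?A \<union> ?B \<union> ?J)"
    using s by (intro finite_measure_mono) auto
  also have "\<dots> \<le> prob ?A + prob ?B + prob ?J"
    using s by (intro order_trans[OF measure_Un_le] add_right_mono measure_Un_le) auto
  also have "prob ?A = tail_fn M (x - a)"
    using N.prob_space by (simp add: measure_pair_Times[OF MN] tail_fn_def)
  also have "prob ?B = tail_fn N (x - a)"
    using M.prob_space by (simp add: measure_pair_Times[OF MN] tail_fn_def)
  finally show ?thesis
    by (simp add: tail_fn_convolution[OF MN] two_big_jumps_def)
qed

text \<open>
  The three events on the right are disjoint as soon as \<open>x \<ge> 0\<close>: in the first only \<open>v\<close> exceeds \<open>a\<close>,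
  in the second only \<open>u\<close>, in the third both.
\<close>

lemma tail_fn_convolution_ge:
  assumes MN: "real_distribution M" "real_distribution N" and x: "0 \<le> x"
  shows "measure M {-a<..a} * tail_fn N (x + a) + measure N {-a<..a} * tail_fn M (x + a)
      + two_big_jumps M N a x \<le> tail_fn (convolution M N) x"
proof -
  interpret pair_prob_space M N by (rule pair_prob_space_real_distributions) fact+
  note sets = sets_pair_real_distributions[OF MN]
  let ?A = "{-a<..a} \<times> {x + a<..}" and ?B = "{x + a<..} \<times> {-a<..a}"
    and ?J = "{(u, v). a < u \<and> a < v \<and> x < u + v}"
  have s: "?A \<in> sets (M \<Otimes>\<^sub>M N)" "?B \<in> sets (M \<Otimes>\<^sub>M N)" "?J \<in> sets (M \<Otimes>\<^sub>M N)"
    using sets_two_big_jumps[of a x] by (auto simp: sets)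
  have "{p \<in> space (borel \<Otimes>\<^sub>M borel). x < fst p + snd p}
      \<in> sets (borel \<Otimes>\<^sub>M borel :: (real \<times> real) measure)"
    by measurable
  then have T: "{(u, v). x < u + v} \<in> sets (M \<Otimes>\<^sub>M N)"
    by (simp add: sets case_prod_beta' space_pair_measure)
  have "prob ?A + prob ?B + prob ?J = prob (?A \<union> ?B \<union> ?J)"
    using s x by (subst finite_measure_Union | force)+
  also have "\<dots> \<le> prob {(u, v). x < u + v}"
    using T by (intro finite_measure_mono) auto
  finally show ?thesis
    unfolding tail_fn_convolution[OF MN]
    by (simp add: measure_pair_Times[OF MN] tail_fn_def two_big_jumps_def mult.commute)
qed

lemma two_big_jumps_commute:
  assumes MN: "real_distribution M" "real_distribution N"
  shows "two_big_jumps M N a x = two_big_jumps N M a x"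
proof -
  interpret M: real_distribution M by fact
  interpret N: real_distribution N by fact
  interpret pair_prob_space M N by (rule pair_prob_space_real_distributions) fact+
  let ?J = "{(u, v). a < u \<and> a < v \<and> x < u + v}"
  have "prob ?J = measure (distr (N \<Otimes>\<^sub>M M) (M \<Otimes>\<^sub>M N) (\<lambda>(x, y). (y, x))) ?J"
    using distr_pair_swap by simp
  also have "\<dots> = measure (N \<Otimes>\<^sub>M M) ((\<lambda>(x, y). (y, x)) -` ?J \<inter> space (N \<Otimes>\<^sub>M M))"
    using sets_two_big_jumps
    by (intro measure_distr measurable_pair_swap') (simp only: sets_pair_real_distributions[OF MN])
  also have "(\<lambda>(x, y). (y, x)) -` ?J \<inter> space (N \<Otimes>\<^sub>M M) = ?J"
    by (auto simp: space_pair_measure)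
  finally show ?thesis
    by (simp add: two_big_jumps_def)
qed

text \<open>
  For fixed \<open>v > a\<close> the section of the event is the half-line above \<open>max a (x - v)\<close>, so only tails of
  the first measure beyond \<open>a\<close> enter.
\<close>

lemma two_big_jumps_mono_left:
  assumes M: "real_distribution M" "real_distribution M'" and N: "real_distribution N"
    and C: "0 \<le> C" and le: "\<And>t. a \<le> t \<Longrightarrow> tail_fn M t \<le> C * tail_fn M' t"
  shows "two_big_jumps M N a x \<le> C * two_big_jumps M' N a x"
proof -
  interpret M: real_distribution M by fact
  interpret M': real_distribution M' by fact
  interpret N: real_distribution N by fact
  interpret MN: pair_prob_space M N by (rule pair_prob_space_real_distributions) fact+
  interpret MN': pair_prob_space M' N by (rule pair_prob_space_real_distributions) fact+
  let ?J = "{(u, v). a < u \<and> a < v \<and> x < u + v}"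
  have sets: "?J \<in> sets (M \<Otimes>\<^sub>M N)" "?J \<in> sets (M' \<Otimes>\<^sub>M N)"
    using sets_two_big_jumps by (simp_all only: sets_pair_real_distributions M N)
  have le': "emeasure M {t<..} \<le> ennreal C * emeasure M' {t<..}" if "a \<le> t" for t
    using le[OF that] C
    by (simp add: tail_fn_def M.emeasure_eq_measure M'.emeasure_eq_measure ennreal_leI
        flip: ennreal_mult)
  have "emeasure (M \<Otimes>\<^sub>M N) ?J = (\<integral>\<^sup>+v. emeasure M ((\<lambda>u. (u, v)) -` ?J) \<partial>N)"
    by (rule MN.emeasure_pair_measure_alt2) fact
  also have "\<dots> \<le> (\<integral>\<^sup>+v. ennreal C * emeasure M' ((\<lambda>u. (u, v)) -` ?J) \<partial>N)"
  proof (intro nn_integral_mono)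
    fix v
    show "emeasure M ((\<lambda>u. (u, v)) -` ?J) \<le> ennreal C * emeasure M' ((\<lambda>u. (u, v)) -` ?J)"
    proof (cases "a < v")
      case True
      then have "(\<lambda>u. (u, v)) -` ?J = {max a (x - v)<..}" by auto
      then show ?thesis using le'[of "max a (x - v)"] by simp
    qed simp
  qed
  also have "\<dots> = ennreal C * (\<integral>\<^sup>+v. emeasure M' ((\<lambda>u. (u, v)) -` ?J) \<partial>N)"
    by (intro nn_integral_cmult MN'.measurable_emeasure_Pair2) fact
  also have "\<dots> = ennreal C * emeasure (M' \<Otimes>\<^sub>M N) ?J"
    by (subst MN'.emeasure_pair_measure_alt2) (use sets in auto)
  finally have "ennreal (two_big_jumps M N a x) \<le> ennreal (C * two_big_jumps M' N a x)"
    using C by (simp add: two_big_jumps_def MN.P.emeasure_eq_measure MN'.P.emeasure_eq_measure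
        ennreal_mult)
  then show ?thesis
    using C by (simp add: two_big_jumps_def)
qed

text \<open>
  The measures are replaced one at a time; symmetry turns the second replacement into the first.
\<close>

lemma two_big_jumps_le_of_tail_le:
  assumes M: "real_distribution M" and N: "real_distribution N" and F: "real_distribution F"
    and C: "0 \<le> C"
    and leM: "\<And>t. a \<le> t \<Longrightarrow> tail_fn M t \<le> C * tail_fn F t"
    and leN: "\<And>t. a \<le> t \<Longrightarrow> tail_fn N t \<le> C * tail_fn F t"
  shows "two_big_jumps M N a x \<le> C\<^sup>2 * two_big_jumps F F a x"
proof -
  have "two_big_jumps M N a x \<le> C * two_big_jumps F N a x"
    by (rule two_big_jumps_mono_left) fact+
  also have "two_big_jumps F N a x = two_big_jumps N F a x"
    by (rule two_big_jumps_commute) fact+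
  also have "\<dots> \<le> C * two_big_jumps F F a x"
    by (rule two_big_jumps_mono_left) fact+
  finally show ?thesis
    using C by (simp add: power2_eq_square mult_left_mono mult.assoc)
qed

section \<open>Tails with increments negligible against a subexponential tail\<close>

lemma tail_fn_nonneg: "0 \<le> tail_fn M x"
  by (simp add: tail_fn_def)

lemma tail_fn_antimono:
  assumes "finite_borel_measure M" "x \<le> y"
  shows "tail_fn M y \<le> tail_fn M x"
proof -
  interpret finite_borel_measure M by fact
  show ?thesis
    unfolding tail_fn_def using assms(2) by (intro finite_measure_mono) (auto simp: M_is_borel)
qed

lemma real_distribution_mass_tendsto_1:
  assumes "real_distribution M"
  shows "((\<lambda>a. measure M {-a<..a}) \<longlongrightarrow> 1) at_top"
proof -
  interpret real_distribution M by fact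
  have "((\<lambda>a. cdf M a - cdf M (-a)) \<longlongrightarrow> 1 - 0) at_top"
    by (intro tendsto_diff cdf_lim_at_top_prob
        filterlim_compose[OF cdf_lim_at_bot filterlim_uminus_at_bot_at_top])
  moreover have "\<forall>\<^sub>F a in at_top. cdf M a - cdf M (-a) = measure M {-a<..a}"
    using eventually_gt_at_top[of 0] by eventually_elim (simp add: cdf_diff_eq)
  ultimately show ?thesis
    by (simp add: tendsto_cong)
qed

text \<open>
  For \<open>g = f\<close> a positive tail this is long-tailedness. Measuring the increments of \<open>g\<close> against a
  separate \<open>f\<close> makes the condition linear in \<open>g\<close> and meaningful for tails that vanish or are much
  lighter than \<open>f\<close>: it is what the hypothesis on \<open>F + G\<close> gives for \<open>G\<close>, which need not be
  long-tailed itself.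
\<close>

definition small_increments :: "(real \<Rightarrow> real) \<Rightarrow> (real \<Rightarrow> real) \<Rightarrow> bool" where
  "small_increments g f \<longleftrightarrow> (\<forall>a. (\<lambda>x. g (x + a) - g x) \<in> o[at_top](f))"

lemma long_tailed_iff_small_increments:
  assumes "finite_borel_measure M" and pos: "\<And>x. 0 < tail_fn M x"
  shows "long_tailed M \<longleftrightarrow> small_increments (tail_fn M) (tail_fn M)"
proof -
  have nz: "tail_fn M x \<noteq> 0" for x using pos[of x] by simp
  have "((\<lambda>x. tail_fn M (x + a) / tail_fn M x) \<longlongrightarrow> 1) at_top
      \<longleftrightarrow> (\<lambda>x. tail_fn M (x + a) - tail_fn M x) \<in> o[at_top](tail_fn M)" for a
  proof -
    have "((\<lambda>x. tail_fn M (x + a) / tail_fn M x) \<longlongrightarrow> 1) at_top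
        \<longleftrightarrow> ((\<lambda>x. (tail_fn M (x + a) - tail_fn M x) / tail_fn M x) \<longlongrightarrow> 0) at_top"
      by (subst LIM_zero_iff[symmetric]) (simp add: diff_divide_distrib nz)
    also have "\<dots> \<longleftrightarrow> (\<lambda>x. tail_fn M (x + a) - tail_fn M x) \<in> o[at_top](tail_fn M)"
      using nz by (auto intro: smalloI_tendsto dest: smalloD_tendsto)
    finally show ?thesis .
  qed
  then show ?thesis
    using assms by (simp add: long_tailed_def small_increments_def)
qed

lemma long_tailed_small_increments:
  "long_tailed M \<Longrightarrow> small_increments (tail_fn M) (tail_fn M)"
  using long_tailed_iff_small_increments by (auto simp: long_tailed_def)

lemma smallo_shift:
  fixes f g :: "real \<Rightarrow> real"
  assumes "g \<in> o[at_top](f)" "small_increments f f"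
  shows "(\<lambda>x. g (x + a)) \<in> o[at_top](f)"
proof -
  have "filterlim (\<lambda>x. x + a) at_top at_top"
    using filterlim_tendsto_add_at_top[OF tendsto_const[of a] filterlim_ident]
    by (simp add: add.commute)
  then have "(\<lambda>x. g (x + a)) \<in> o[at_top](\<lambda>x. f (x + a))"
    by (rule landau_o.small.compose[OF assms(1)])
  also have "(\<lambda>x. f (x + a)) \<in> O[at_top](f)"
  proof -
    have "(\<lambda>x. (f (x + a) - f x) + f x) \<in> O[at_top](f)"
      using assms(2) by (intro sum_in_bigo(1) landau_o.big_refl landau_o.small_imp_big)
        (simp add: small_increments_def)
    then show ?thesis by simp
  qed
  finally show ?thesis .
qed

lemma small_increments_perturb:
  fixes f g h :: "real \<Rightarrow> real"
  assumes "small_increments g f" "(\<lambda>x. h x - g x) \<in> o[at_top](f)" "small_increments f f"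
  shows "small_increments h f"
  unfolding small_increments_def
proof
  fix a
  have "(\<lambda>x. (h (x + a) - g (x + a)) + (g (x + a) - g x) - (h x - g x)) \<in> o[at_top](f)"
    using assms(1)
    by (intro sum_in_smallo(2)[OF sum_in_smallo(1) assms(2)] smallo_shift[OF assms(2,3)])
      (simp add: small_increments_def)
  then show "(\<lambda>x. h (x + a) - h x) \<in> o[at_top](f)"
    by simp
qed

text \<open>
  Subtracting from \<open>tail_fn (F * F) x \<approx> 2 * tail_fn F x\<close> the two contributions of a single big jump
  leaves almost nothing for two big jumps.
\<close>

lemma two_big_jumps_small:
  assumes F: "subexponential F" and "0 \<le> a" "0 < d" and mass: "1 - d \<le> measure F {-a<..a}"
  shows "\<forall>\<^sub>F x in at_top. two_big_jumps F F a x \<le> 5 * d * tail_fn F x"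
proof -
  let ?f = "tail_fn F"
  have D: "real_distribution F" and L: "long_tailed F"
    and S: "(\<lambda>x. tail_fn (convolution F F) x - 2 * ?f x) \<in> o[at_top](?f)"
    using F by (auto simp: subexponential_def)
  interpret real_distribution F by fact
  have "(\<lambda>x. ?f (x + a) - ?f x) \<in> o[at_top](?f)"
    using long_tailed_small_increments[OF L] by (simp add: small_increments_def)
  from landau_o.smallD[OF this \<open>0 < d\<close>] landau_o.smallD[OF S \<open>0 < d\<close>] eventually_ge_at_top[of 0]
  show ?thesis
  proof eventually_elim
    case (elim x)
    have shift: "\<bar>?f (x + a) - ?f x\<bar> \<le> d * ?f x"
      and conv: "\<bar>tail_fn (convolution F F) x - 2 * ?f x\<bar> \<le> d * ?f x"
      using elim(1,2) by (simp_all add: tail_fn_nonneg)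
    have "d * ?f (x + a) \<le> d * ?f x"
      using \<open>0 < d\<close> \<open>0 \<le> a\<close> tail_fn_antimono[OF finite_borel_measure_M, of x "x + a"] by simp
    moreover have "(1 - d) * ?f (x + a) \<le> measure F {-a<..a} * ?f (x + a)"
      by (intro mult_right_mono mass tail_fn_nonneg)
    ultimately have "?f x - 2 * (d * ?f x) \<le> measure F {-a<..a} * ?f (x + a)"
      using shift by (simp add: left_diff_distrib)
    then show ?case
      using tail_fn_convolution_ge[OF D D elim(3), of a] conv
      by (simp add: abs_le_iff algebra_simps)
  qed
qed

text \<open>
  The level \<open>a\<close> is fixed first, so large that the mass of each measure outside \<open>{-a<..a}\<close> is at
  most \<open>d\<close> and the bounds on the two tails hold beyond \<open>a\<close>; letting \<open>x\<close> grow then makes the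
  shifts by \<open>a\<close> harmless.
\<close>

lemma tail_fn_convolution_asymp:
  assumes F: "subexponential F" and MN: "real_distribution M" "real_distribution N"
    and M: "tail_fn M \<in> O[at_top](tail_fn F)" "small_increments (tail_fn M) (tail_fn F)"
    and N: "tail_fn N \<in> O[at_top](tail_fn F)" "small_increments (tail_fn N) (tail_fn F)"
  shows "(\<lambda>x. tail_fn (convolution M N) x - (tail_fn M x + tail_fn N x)) \<in> o[at_top](tail_fn F)"
proof (rule landau_o.smallI)
  fix e :: real assume "0 < e"
  let ?f = "tail_fn F" and ?m = "tail_fn M" and ?n = "tail_fn N"
  have D: "real_distribution F"
    using F by (simp add: subexponential_def)
  interpret M: real_distribution M by fact
  interpret N: real_distribution N by fact
  obtain c1 where c1: "0 < c1" "\<forall>\<^sub>F x in at_top. norm (?m x) \<le> c1 * norm (?f x)"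
    using M(1) by (rule landau_o.bigE)
  obtain c2 where c2: "0 < c2" "\<forall>\<^sub>F x in at_top. norm (?n x) \<le> c2 * norm (?f x)"
    using N(1) by (rule landau_o.bigE)
  define C where "C = max c1 c2"
  have "0 < C" using c1 by (simp add: C_def)
  have bound: "\<forall>\<^sub>F t in at_top. ?m t \<le> C * ?f t \<and> ?n t \<le> C * ?f t"
    using c1(2) c2(2)
  proof eventually_elim
    case (elim t)
    have "c1 * ?f t \<le> C * ?f t" "c2 * ?f t \<le> C * ?f t"
      by (simp_all add: C_def mult_right_mono tail_fn_nonneg)
    then show ?case using elim by (simp add: tail_fn_nonneg)
  qed
  \<comment> \<open>The excess over \<open>?m x + ?n x\<close> will be at most \<open>2 d + 5 C\<^sup>2 d\<close> and the deficit at most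
    \<open>2 d + 2 C d\<close> times \<open>?f x\<close>.\<close>
  define d where "d = e / (2 + 5 * C\<^sup>2 + 2 * C)"
  have den: "0 < 2 + 5 * C\<^sup>2 + 2 * C"
    using \<open>0 < C\<close> by (simp add: add_pos_nonneg)
  have "0 < d"
    using \<open>0 < e\<close> den by (simp add: d_def)
  have "d * (2 + 5 * C\<^sup>2 + 2 * C) = e"
    using den by (simp add: d_def)
  then have d: "2 * d + 5 * C\<^sup>2 * d + 2 * C * d = e"
    by (simp add: algebra_simps)
  have mass: "\<forall>\<^sub>F a in at_top. 1 - d < measure K {-a<..a}" if "real_distribution K" for K
    using order_tendstoD(1)[OF real_distribution_mass_tendsto_1[OF that], of "1 - d"] \<open>0 < d\<close> by simp
  have "\<forall>\<^sub>F a in at_top. 0 \<le> a \<and> (\<forall>t\<ge>a. ?m t \<le> C * ?f t \<and> ?n t \<le> C * ?f t)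
      \<and> 1 - d < measure F {-a<..a} \<and> 1 - d < measure M {-a<..a} \<and> 1 - d < measure N {-a<..a}"
    using eventually_ge_at_top[of 0] eventually_all_ge_at_top[OF bound]
      mass[OF D] mass[OF MN(1)] mass[OF MN(2)]
    by eventually_elim simp
  then obtain a where a: "0 \<le> a" "\<And>t. a \<le> t \<Longrightarrow> ?m t \<le> C * ?f t" "\<And>t. a \<le> t \<Longrightarrow> ?n t \<le> C * ?f t"
      "1 - d \<le> measure F {-a<..a}" "1 - d \<le> measure M {-a<..a}" "1 - d \<le> measure N {-a<..a}"
    by (auto simp: eventually_at_top_linorder intro: less_imp_le)
  have incr: "\<forall>\<^sub>F x in at_top. \<bar>g (x + b) - g x\<bar> \<le> d * ?f x"
    if "small_increments g ?f" for g b
    using that landau_o.smallD[OF _ \<open>0 < d\<close>, of "\<lambda>x. g (x + b) - g x" at_top ?f]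
    by (simp add: small_increments_def tail_fn_nonneg)
  from incr[OF M(2), of a] incr[OF N(2), of a] incr[OF M(2), of "-a"] incr[OF N(2), of "-a"]
    two_big_jumps_small[OF F a(1) \<open>0 < d\<close> a(4)]
    eventually_ge_at_top[of a]
  show "\<forall>\<^sub>F x in at_top. norm (tail_fn (convolution M N) x - (?m x + ?n x)) \<le> e * norm (?f x)"
  proof eventually_elim
    case (elim x)
    have x: "0 \<le> x" "a \<le> x"
      using a(1) elim(6) by simp_all
    have f: "0 \<le> ?f x" by (rule tail_fn_nonneg)
    have "two_big_jumps M N a x \<le> C\<^sup>2 * two_big_jumps F F a x"
      using \<open>0 < C\<close> a(2,3) by (intro two_big_jumps_le_of_tail_le MN D) auto
    also have "\<dots> \<le> C\<^sup>2 * (5 * d * ?f x)"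
      using elim(5) by (intro mult_left_mono) auto
    finally have "two_big_jumps M N a x \<le> 5 * C\<^sup>2 * d * ?f x"
      by (simp add: mult_ac)
    then have upper: "tail_fn (convolution M N) x - (?m x + ?n x) \<le> (2 * d + 5 * C\<^sup>2 * d) * ?f x"
      using tail_fn_convolution_le[OF MN, of x a] elim(3,4) by (simp add: distrib_right)
    \<comment> \<open>One unit of the loss \<open>d * ?f x\<close> is due to the shift by \<open>a\<close>, the other \<open>C\<close> to the mass
      missing from \<open>p\<close>.\<close>
    have shift: "k x - (1 + C) * (d * ?f x) \<le> p * k (x + a)"
      if "k = tail_fn K" "real_distribution K" "1 - d \<le> p" "k x \<le> C * ?f x"
        "\<bar>k (x + a) - k x\<bar> \<le> d * ?f x" for k K p
    proof -
      interpret K: real_distribution K by fact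
      have "k (x + a) \<le> k x"
        unfolding \<open>k = _\<close> using a(1) by (intro tail_fn_antimono K.finite_borel_measure_M) simp
      then have "d * k (x + a) \<le> d * (C * ?f x)"
        using \<open>0 < d\<close> that(4) by (intro mult_left_mono) auto
      moreover have "(1 - d) * k (x + a) \<le> p * k (x + a)"
        unfolding \<open>k = _\<close> by (intro mult_right_mono that(3) tail_fn_nonneg)
      ultimately show ?thesis
        using that(5) by (simp add: algebra_simps)
    qed
    have "0 \<le> two_big_jumps M N a x"
      by (simp add: two_big_jumps_def)
    then have lower: "- ((2 * d + 2 * C * d) * ?f x) \<le> tail_fn (convolution M N) x - (?m x + ?n x)"
      using tail_fn_convolution_ge[OF MN x(1), of a] shift[OF refl MN(1) a(6) a(2)[OF x(2)] elim(1)]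
        shift[OF refl MN(2) a(5) a(3)[OF x(2)] elim(2)]
      by (simp add: algebra_simps)
    have "(2 * d + 5 * C\<^sup>2 * d) * ?f x \<le> e * ?f x" "(2 * d + 2 * C * d) * ?f x \<le> e * ?f x"
      using \<open>0 < C\<close> \<open>0 < d\<close> f by (intro mult_right_mono; simp flip: d)+
    then show ?case
      using upper lower f by (simp add: abs_le_iff)
  qed
qed

section \<open>Convolution with a measure of comparable tail\<close>

theorem corollary18:
  fixes F G :: "real measure"
  assumes "real_distribution F"
    and "real_distribution G"
    and "subexponential F"
    and "long_tailed (measure_sum F G)"
    and "tail_fn G \<in> O[at_top](tail_fn F)"
  shows "subexponential (convolution F G) \<and>
    (\<lambda>x. tail_fn (convolution F G) x - (tail_fn F x + tail_fn G x)) \<in> o[at_top](tail_fn F)"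
proof -
  define H where "H = convolution F G"
  let ?f = "tail_fn F" and ?g = "tail_fn G" and ?h = "tail_fn H"
  interpret F: real_distribution F by fact
  interpret G: real_distribution G by fact
  have H: "real_distribution H"
    unfolding H_def by (rule real_distribution_convolution) fact+
  interpret H: real_distribution H by fact
  have L: "long_tailed F"
    using assms(3) by (simp add: subexponential_def)
  then have f_pos: "0 < ?f x" for x
    by (simp add: long_tailed_def)
  have incr_f: "small_increments ?f ?f"
    by (rule long_tailed_small_increments) fact
  have sum_bigo: "(\<lambda>x. ?f x + ?g x) \<in> O[at_top](?f)"
    using assms(5) by (intro sum_in_bigo) simp_all
  have "tail_fn (measure_sum F G) = (\<lambda>x. ?f x + ?g x)"
    by (rule ext) (intro tail_fn_measure_sum F.finite_borel_measure_M G.finite_borel_measure_M)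
  then have incr_sum: "small_increments (\<lambda>x. ?f x + ?g x) ?f"
    using long_tailed_small_increments[OF assms(4)] sum_bigo
    by (auto simp: small_increments_def intro: landau_o.small_big_trans)
  have incr_g: "small_increments ?g ?f"
    unfolding small_increments_def
  proof
    fix a
    have "(\<lambda>x. ((?f (x + a) + ?g (x + a)) - (?f x + ?g x)) - (?f (x + a) - ?f x)) \<in> o[at_top](?f)"
      by (rule sum_in_smallo(2)) (use incr_sum incr_f in \<open>simp_all add: small_increments_def\<close>)
    then show "(\<lambda>x. ?g (x + a) - ?g x) \<in> o[at_top](?f)"
      by simp
  qed

  have asymp: "(\<lambda>x. ?h x - (?f x + ?g x)) \<in> o[at_top](?f)"
    unfolding H_def
    by (rule tail_fn_convolution_asymp) (use assms incr_f incr_g in simp_all)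
  have incr_h: "small_increments ?h ?f"
    by (rule small_increments_perturb[OF incr_sum asymp incr_f])
  have h_bigo: "?h \<in> O[at_top](?f)"
    using sum_in_bigo(1)[OF landau_o.small_imp_big[OF asymp] sum_bigo] by simp
  have h_ge: "\<forall>\<^sub>F x in at_top. ?f x \<le> 2 * ?h x"
    using landau_o.smallD[OF asymp, of "1 / 2"]
  proof (rule eventually_mono)
    fix x assume "norm (?h x - (?f x + ?g x)) \<le> 1 / 2 * norm (?f x)"
    then show "?f x \<le> 2 * ?h x"
      using tail_fn_nonneg[of F x] tail_fn_nonneg[of G x]
      unfolding real_norm_def by linarith
  qed simp
  then have f_bigo: "?f \<in> O[at_top](?h)"
    by (intro landau_o.bigI[of 2]) (simp_all add: tail_fn_nonneg)

  \<comment> \<open>The asymptotics give positivity only for large arguments; monotonicity of the tail carries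
    it back to all others.\<close>
  have h_pos: "0 < ?h x" for x
  proof -
    obtain y where "x \<le> y" "?f y \<le> 2 * ?h y"
      using h_ge by (auto simp: eventually_at_top_linorder) (meson linear max.cobounded1 max.cobounded2)
    then show ?thesis
      using f_pos[of y] tail_fn_antimono[OF H.finite_borel_measure_M, of x y] by simp
  qed
  have "small_increments ?h ?h"
    using incr_h f_bigo by (auto simp: small_increments_def intro: landau_o.small_big_trans)
  then have "long_tailed H"
    by (subst long_tailed_iff_small_increments) (auto intro: H.finite_borel_measure_M h_pos)
  moreover have "(\<lambda>x. tail_fn (convolution H H) x - 2 * ?h x) \<in> o[at_top](?h)"
    using landau_o.small_big_trans[OF
        tail_fn_convolution_asymp[OF assms(3) H H h_bigo incr_h h_bigo incr_h] f_bigo]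
    by simp
  ultimately show ?thesis
    using H asymp unfolding subexponential_def H_def by simp
qed

end
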